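(* Suppose $\frac{h_1}{\mu_1}\le\frac{h_2}{\mu_2}$ and consider $\ell\in\{0,1,\dots,C_1-1\}$. 1. $\tilde i_D(\ell)$ is non-decreasing in $\ell$: $\tilde i_D(\ell-1)\le\tilde i_D(\ell)$ for $\ell=1,2,\dots,C_1-1$. 2. If $\mu_1<\mu_2$ and $\ell<C_2$, then $\tilde i_H(\ell)\le\tilde i_D(\ell)\le\tilde i_H(\ell)+(C_1-1)$. Otherwise (either $\mu_1\ge\mu_2$ and $\ell<C_2$, or $\ell\ge C_2$), both $\tilde i_H(\ell)$ and $\tilde i_D(\ell)$ are infinite.
   Context: Let $C_1,C_2\ge1$ be integers with $C_2<C_1$, and $\mu_1,\mu_2,h_0,h_1,h_2>0$ real. Write $\mathbb{Z}_+=\{0,1,2,\dots\}$. Let $$\mathbb{X}=\{(i,k,\ell)\in\mathbb{Z}_+^3 : (i=0 \text{ and } k+\ell<C_1)\text{ or }(i\ge0\text{ and }k+\ell=C_1)\},\qquad d(k,\ell)=k\mu_1+\min\{\ell,C_2\}\mu_2 .$$ The value function $v:\mathbb{X}\to\mathbb{R}$ (optimal expected total holding cost of a clearing queueing system with $i$ jobs in queue, $k$ jobs in independent service and $\ell$ jobs at the collaborative station) is determined by $v(0,0,0)=0$, $$v(0,k,\ell)=\tfrac{kh_1+\ell h_2}{d(k,\ell)}+\tfrac{k\mu_1}{d(k,\ell)}v(0,k-1,\ell)+\tfrac{\min\{\ell,C_2\}\mu_2}{d(k,\ell)}v(0,k,\ell-1)\quad ((k,\ell)\ne(0,0)),$$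 and for $i\ge1$, $$v(i,k,\ell)=\tfrac{ih_0+kh_1+\ell h_2}{d(k,\ell)}+\tfrac{k\mu_1}{d(k,\ell)}\min\{v(i-1,k,\ell),v(i-1,k-1,\ell+1)\}+\tfrac{\min\{\ell,C_2\}\mu_2}{d(k,\ell)}\min\{v(i-1,k+1,\ell-1),v(i-1,k,\ell)\},$$ where terms with coefficient $0$ are read as $0$. For $(i,k,\ell)\in\mathbb{X}$ with $k\ge1$ let $D(i,k,\ell)=v(i,k,\ell)-v(i,k-1,\ell+1)$. Put $m=\mu_2/\mu_1$, $$c=\tfrac{h_0}{C_1}\bigl(\tfrac1{\mu_1}-\tfrac1{\mu_2}\bigr),\quad b=\tfrac{h_1}{\mu_1}-\tfrac{h_2}{\mu_2},\quad c'=-\tfrac{h_0}{C_2\mu_2},\quad b'=\tfrac{h_1-h_2}{\mu_1}-\tfrac{C_1h_2}{C_2\mu_2},\quad y_k=(k-1)+\min\{C_1-k,C_2\}m.$$ For $i\in\mathbb{Z}_+$, $0\le\ell\le C_1-1$, $k=C_1-\ell$, define $$H(i,k,\ell)=\begin{cases}-1&\text{if }\ell\ge C_2\text{ and }\frac{h_1}{\mu_1}\le\frac{\ell+1}{C_2}\frac{h_2}{\mu_2},\\(i-y_k)c'+b'&\text{if }\ell\ge C_2\text{ and }\frac{h_1}{\mu_1}>\frac{\ell+1}{C_2}\frac{h_2}{\mu_2},\\ ic+b&\text{if }\ell<C_2.\end{cases}$$ The actual and estimated integer thresholds are $\tilde i_D(\ell)=\min\{i\in\mathbb{Z}_+: D(i,C_1-\ell,\ell)>0\}$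 and $\tilde i_H(\ell)=\min\{i\in\mathbb{Z}_+: H(i,C_1-\ell,\ell)>0\}$, with $\min\emptyset=\infty$. *)

theory Defs
  imports Complex_Main "HOL-Library.Extended_Nat"
begin

text \<open>
  States are triples \<open>(i, k, l)\<close>: \<open>i\<close> jobs in queue, \<open>k\<close> jobs in independent service and
  \<open>l\<close> jobs at the collaborative station.
\<close>

definition state_space :: "nat \<Rightarrow> (nat \<times> nat \<times> nat) set" where
  "state_space C1 = {(i, k, l). (i = 0 \<and> k + l < C1) \<or> k + l = C1}"

definition drate :: "nat \<Rightarrow> real \<Rightarrow> real \<Rightarrow> nat \<Rightarrow> nat \<Rightarrow> real" where
  "drate C2 \<mu>1 \<mu>2 k l = real k * \<mu>1 + real (min l C2) * \<mu>2"

text \<open>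
  The value function is given as a total function on all triples; the recursion does not mention
  \<open>C1\<close>, and it never leaves \<open>state_space C1\<close> when started there (see
  \<open>value_fun_unique\<close> below). The conditionals encode the convention that terms with coefficient
  \<open>0\<close> are \<open>0\<close>.
\<close>

fun value_fun :: "nat \<Rightarrow> real \<Rightarrow> real \<Rightarrow> real \<Rightarrow> real \<Rightarrow> real \<Rightarrow> nat \<Rightarrow> nat \<Rightarrow> nat \<Rightarrow> real" where
  "value_fun C2 \<mu>1 \<mu>2 h0 h1 h2 0 k l =
     (if k = 0 \<and> l = 0 then 0
      else (real k * h1 + real l * h2) / drate C2 \<mu>1 \<mu>2 k l
         + (if k = 0 then 0
            else real k * \<mu>1 / drate C2 \<mu>1 \<mu>2 k l * value_fun C2 \<mu>1 \<mu>2 h0 h1 h2 0 (k - 1) l)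
         + (if l = 0 then 0
            else real (min l C2) * \<mu>2 / drate C2 \<mu>1 \<mu>2 k l
                 * value_fun C2 \<mu>1 \<mu>2 h0 h1 h2 0 k (l - 1)))"
| "value_fun C2 \<mu>1 \<mu>2 h0 h1 h2 (Suc i) k l =
     (real (Suc i) * h0 + real k * h1 + real l * h2) / drate C2 \<mu>1 \<mu>2 k l
     + (if k = 0 then 0
        else real k * \<mu>1 / drate C2 \<mu>1 \<mu>2 k l
             * min (value_fun C2 \<mu>1 \<mu>2 h0 h1 h2 i k l)
                   (value_fun C2 \<mu>1 \<mu>2 h0 h1 h2 i (k - 1) (l + 1)))
     + (if l = 0 then 0
        else real (min l C2) * \<mu>2 / drate C2 \<mu>1 \<mu>2 k l
             * min (value_fun C2 \<mu>1 \<mu>2 h0 h1 h2 i (k + 1) (l - 1))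
                   (value_fun C2 \<mu>1 \<mu>2 h0 h1 h2 i k l))"

lemma value_fun_unique:
  fixes w :: "nat \<Rightarrow> nat \<Rightarrow> nat \<Rightarrow> real"
  assumes zero: "w 0 0 0 = 0"
    and idle: "\<And>k l. (0, k, l) \<in> state_space C1 \<Longrightarrow> (k, l) \<noteq> (0, 0) \<Longrightarrow>
      w 0 k l = (real k * h1 + real l * h2) / drate C2 \<mu>1 \<mu>2 k l
        + real k * \<mu>1 / drate C2 \<mu>1 \<mu>2 k l * w 0 (k - 1) l
        + real (min l C2) * \<mu>2 / drate C2 \<mu>1 \<mu>2 k l * w 0 k (l - 1)"
    and busy: "\<And>i k l. (i, k, l) \<in> state_space C1 \<Longrightarrow> 1 \<le> i \<Longrightarrow>
      w i k l = (real i * h0 + real k * h1 + real l * h2) / drate C2 \<mu>1 \<mu>2 k l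
        + real k * \<mu>1 / drate C2 \<mu>1 \<mu>2 k l * min (w (i - 1) k l) (w (i - 1) (k - 1) (l + 1))
        + real (min l C2) * \<mu>2 / drate C2 \<mu>1 \<mu>2 k l
            * min (w (i - 1) (k + 1) (l - 1)) (w (i - 1) k l)"
    and "(i, k, l) \<in> state_space C1"
  shows "w i k l = value_fun C2 \<mu>1 \<mu>2 h0 h1 h2 i k l"
  using assms(4)
proof (induction i arbitrary: k l)
  case 0
  then show ?case
  proof (induction "k + l" arbitrary: k l rule: less_induct)
    case less
    show ?case
    proof (cases "(k, l) = (0, 0)")
      case True
      then show ?thesis using zero by simp
    next
      case False
      have A: "w 0 (k - 1) l = value_fun C2 \<mu>1 \<mu>2 h0 h1 h2 0 (k - 1) l" if "k \<noteq> 0"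
        using less that by (auto simp: state_space_def simp del: value_fun.simps)
      have B: "w 0 k (l - 1) = value_fun C2 \<mu>1 \<mu>2 h0 h1 h2 0 k (l - 1)" if "l \<noteq> 0"
        using less that by (auto simp: state_space_def simp del: value_fun.simps)
      show ?thesis
        unfolding idle[OF less.prems False] value_fun.simps(1)[of _ _ _ _ _ _ k l]
        using False A B by (auto simp del: value_fun.simps)
    qed
  qed
next
  case (Suc i)
  have S: "k + l = C1"
    using Suc.prems by (simp add: state_space_def)
  have IH: "w i a b = value_fun C2 \<mu>1 \<mu>2 h0 h1 h2 i a b" if "a + b = C1" for a b
    using Suc.IH[of a b] that by (simp add: state_space_def)
  show ?case
    unfolding value_fun.simps(2) using busy[OF Suc.prems] S
    by (auto simp: IH simp del: value_fun.simps)
qed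

definition D_fun :: "nat \<Rightarrow> real \<Rightarrow> real \<Rightarrow> real \<Rightarrow> real \<Rightarrow> real \<Rightarrow> nat \<Rightarrow> nat \<Rightarrow> nat \<Rightarrow> real" where
  "D_fun C2 \<mu>1 \<mu>2 h0 h1 h2 i k l =
     value_fun C2 \<mu>1 \<mu>2 h0 h1 h2 i k l - value_fun C2 \<mu>1 \<mu>2 h0 h1 h2 i (k - 1) (l + 1)"

definition y_fun :: "nat \<Rightarrow> nat \<Rightarrow> real \<Rightarrow> real \<Rightarrow> nat \<Rightarrow> real" where
  "y_fun C1 C2 \<mu>1 \<mu>2 k = (real k - 1) + real (min (C1 - k) C2) * (\<mu>2 / \<mu>1)"

definition H_fun ::
  "nat \<Rightarrow> nat \<Rightarrow> real \<Rightarrow> real \<Rightarrow> real \<Rightarrow> real \<Rightarrow> real \<Rightarrow> nat \<Rightarrow> nat \<Rightarrow> nat \<Rightarrow> real" where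
  "H_fun C1 C2 \<mu>1 \<mu>2 h0 h1 h2 i k l =
     (let c = h0 / real C1 * (1 / \<mu>1 - 1 / \<mu>2);
          b = h1 / \<mu>1 - h2 / \<mu>2;
          c' = - h0 / (real C2 * \<mu>2);
          b' = (h1 - h2) / \<mu>1 - real C1 * h2 / (real C2 * \<mu>2)
      in if l \<ge> C2 then
           (if h1 / \<mu>1 \<le> (real l + 1) / real C2 * (h2 / \<mu>2) then - 1
            else (real i - y_fun C1 C2 \<mu>1 \<mu>2 k) * c' + b')
         else real i * c + b)"

text \<open>In \<^typ>\<open>enat\<close> the infimum of a nonempty set is its least element and \<open>Inf {} = \<infinity>\<close>.\<close>

definition i_D :: "nat \<Rightarrow> nat \<Rightarrow> real \<Rightarrow> real \<Rightarrow> real \<Rightarrow> real \<Rightarrow> real \<Rightarrow> nat \<Rightarrow> enat" where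
  "i_D C1 C2 \<mu>1 \<mu>2 h0 h1 h2 l = Inf (enat ` {i. D_fun C2 \<mu>1 \<mu>2 h0 h1 h2 i (C1 - l) l > 0})"

definition i_H :: "nat \<Rightarrow> nat \<Rightarrow> real \<Rightarrow> real \<Rightarrow> real \<Rightarrow> real \<Rightarrow> real \<Rightarrow> nat \<Rightarrow> enat" where
  "i_H C1 C2 \<mu>1 \<mu>2 h0 h1 h2 l = Inf (enat ` {i. H_fun C1 C2 \<mu>1 \<mu>2 h0 h1 h2 i (C1 - l) l > 0})"

end

theory Submission
  imports Defs
begin

text \<open>
  Along the states with \<open>k + l = C1\<close>, which \<open>l\<close> determines, \<open>D\<close> obeys a closed recursion in
  \<open>i\<close>: the value \<open>D (i + 1) l\<close> (\<open>gap\<close> below) is a one-step cost gap plus a combination, with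
  nonnegative coefficients, of the positive parts of \<open>D i l\<close>, \<open>D i (l + 1)\<close> and the negative parts
  of \<open>D i l\<close>, \<open>D i (l - 1)\<close> (\<open>gap_step\<close>). The recursion is therefore monotone, and comparisons of
  \<open>D\<close> with explicit bounds, or between neighbouring \<open>l\<close>, carry over from \<open>i\<close> to \<open>i + 1\<close>.
  Two facts start them. With an empty queue the two stations do not interact, so \<open>v 0 k l\<close> splits
  into a sum over the two stations and \<open>D 0 l \<le> b \<le> 0\<close>, with equality \<open>D 0 l = b\<close> for \<open>l < C2\<close>.
  The one-step cost gap is at most \<open>0\<close> for \<open>l \<ge> C2\<close>, and for \<open>l < C2\<close> it is a positive weight
  \<open>\<theta>\<close> (\<open>weight\<close>) times \<open>F i = i * c + b\<close> (\<open>est\<close>), the very expression that defines the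
  estimate \<open>H\<close>; moreover the coefficients of the recursion then add up to \<open>1 - \<theta>\<close> on each side of
  zero.

  Hence \<open>D\<close> stays nonpositive for \<open>l \<ge> C2\<close>, and everywhere if \<open>\<mu>1 \<ge> \<mu>2\<close>, where no \<open>F i\<close> is
  positive. These are the infinite thresholds.

  Let \<open>\<mu>1 < \<mu>2\<close> and \<open>l < C2\<close>. As long as \<open>F i \<le> 0\<close>, averaging keeps \<open>D i l \<le> F i\<close>, so \<open>D\<close> cannot
  turn positive before \<open>F\<close> does; this is the lower bound on the threshold. For the upper bound, the
  recursion restricted to negative parts has the exact solution
  \<open>F i - c * lag l\<close> with \<open>lag l = (k - 1) * \<mu>1 / \<mu>2 + l\<close>: \<open>D\<close> trails \<open>F\<close> by at most \<open>lag l\<close> units of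
  \<open>i\<close>, and \<open>lag l \<le> C1 - 1\<close> (\<open>gap_ge_lagged\<close>). Finally \<open>\<theta>\<close> decreases in \<open>l\<close>, so states with
  smaller \<open>l\<close> are pulled towards \<open>F\<close> faster; this makes the negative part of \<open>D i\<close> nonincreasing
  in \<open>l\<close> and lets \<open>D i l\<close> be positive only if \<open>D i (l - 1)\<close> already is (\<open>gap_single_crossing\<close>), which
  orders the thresholds.
\<close>

section \<open>The recursion for the value differences\<close>

locale clearing_system =
  fixes n C2 :: nat and \<mu>1 \<mu>2 h0 h1 h2 :: real
  assumes C2_pos: "1 \<le> C2" and C2_less: "C2 < n"
    and \<mu>1_pos: "\<mu>1 > 0" and \<mu>2_pos: "\<mu>2 > 0"
    and h0_pos: "h0 > 0" and h1_pos: "h1 > 0" and h2_pos: "h2 > 0"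
    and cost_rate_le: "h1 / \<mu>1 \<le> h2 / \<mu>2"
begin

definition val :: "nat \<Rightarrow> nat \<Rightarrow> real" where
  "val i l = value_fun C2 \<mu>1 \<mu>2 h0 h1 h2 i (n - l) l"

definition gap :: "nat \<Rightarrow> nat \<Rightarrow> real" where
  "gap i l = D_fun C2 \<mu>1 \<mu>2 h0 h1 h2 i (n - l) l"

definition rate :: "nat \<Rightarrow> real" where
  "rate l = drate C2 \<mu>1 \<mu>2 (n - l) l"

definition indep_prob :: "nat \<Rightarrow> real" where
  "indep_prob l = real (n - l) * \<mu>1 / rate l"

definition collab_prob :: "nat \<Rightarrow> real" where
  "collab_prob l = real (min l C2) * \<mu>2 / rate l"

definition step_cost :: "nat \<Rightarrow> nat \<Rightarrow> real" where
  "step_cost i l = (real i * h0 + real (n - l) * h1 + real l * h2) / rate l"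

lemma gap_eq: "gap i l = val i l - val i (Suc l)"
  by (simp add: gap_def val_def D_fun_def)

lemma rate_pos:
  assumes "l \<le> n"
  shows "rate l > 0"
proof (cases "l = 0")
  case True
  then show ?thesis
    using C2_less \<mu>1_pos by (simp add: rate_def drate_def)
next
  case False
  then have "real (min l C2) * \<mu>2 > 0"
    using C2_pos \<mu>2_pos by simp
  moreover have "real (n - l) * \<mu>1 \<ge> 0"
    using \<mu>1_pos by simp
  ultimately show ?thesis
    by (simp add: rate_def drate_def)
qed

lemma prob_sum: "l \<le> n \<Longrightarrow> indep_prob l + collab_prob l = 1"
  using rate_pos[of l]
  by (simp add: indep_prob_def collab_prob_def add_divide_distrib[symmetric])
    (simp add: rate_def drate_def)

lemma indep_prob_nonneg: "l \<le> n \<Longrightarrow> indep_prob l \<ge> 0"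
  using rate_pos[of l] \<mu>1_pos by (simp add: indep_prob_def)

lemma collab_prob_nonneg: "l \<le> n \<Longrightarrow> collab_prob l \<ge> 0"
  using rate_pos[of l] \<mu>2_pos by (simp add: collab_prob_def)

lemma indep_prob_n [simp]: "indep_prob n = 0"
  by (simp add: indep_prob_def)

lemma collab_prob_0 [simp]: "collab_prob 0 = 0"
  by (simp add: collab_prob_def)

lemma val_Suc:
  assumes "l \<le> n"
  shows "val (Suc i) l = step_cost (Suc i) l
    + indep_prob l * min (val i l) (val i (Suc l))
    + collab_prob l * min (val i (l - 1)) (val i l)"
proof -
  have drop: "(if j = 0 then 0 else real j * x / y * z) = real j * x / y * z"
      "(if l = 0 then 0 else real (min l C2) * x / y * z) = real (min l C2) * x / y * z"
    for j x y z
    by simp_all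
  have prev: "real (min l C2) * x / y * min (value_fun C2 \<mu>1 \<mu>2 h0 h1 h2 i (n - l + 1) (l - 1)) z
      = real (min l C2) * x / y * min (val i (l - 1)) z" for x y z
  proof (cases "l = 0")
    case False
    then have "n - l + 1 = n - (l - 1)"
      using assms by simp
    then show ?thesis
      by (simp add: val_def)
  qed simp
  show ?thesis
    unfolding val_def[of "Suc i"] value_fun.simps(2) drop prev
    by (simp add: val_def step_cost_def indep_prob_def collab_prob_def rate_def)
qed

text \<open>
  Both minima in the optimality equation are reached from the value of staying in the same state
  by subtracting a positive part or adding a negative part of a difference. The contributions of
  \<open>gap i l\<close> itself from the states \<open>l\<close> and \<open>l + 1\<close> combine because the transition probabilities
  out of each state add up to one. Only nonnegative coefficients remain. At \<open>l = 0\<close> and \<open>l = n - 1\<close>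
  the neighbours outside the range carry coefficient \<open>0\<close>.
\<close>

lemma gap_step:
  assumes "l < n"
  shows "gap (Suc i) l = (step_cost (Suc i) l - step_cost (Suc i) (Suc l))
    + collab_prob l * max (gap i l) 0 + indep_prob (Suc l) * min (gap i l) 0
    + collab_prob l * min (gap i (l - 1)) 0 + indep_prob (Suc l) * max (gap i (Suc l)) 0"
proof -
  have min1: "min (val i j) (val i (Suc j)) = val i j - max (gap i j) 0" for j
    by (simp add: gap_eq min_def max_def)
  have min2: "min (val i j) (val i (Suc j)) = val i (Suc j) + min (gap i j) 0" for j
    by (simp add: gap_eq min_def)
  have "collab_prob l * min (val i (l - 1)) (val i l)
      = collab_prob l * (val i l + min (gap i (l - 1)) 0)"
    using min2[of "l - 1"] by (cases "l = 0") simp_all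
  then have here: "val (Suc i) l = step_cost (Suc i) l
      + indep_prob l * (val i l - max (gap i l) 0)
      + collab_prob l * (val i l + min (gap i (l - 1)) 0)"
    using val_Suc[of l i] assms by (simp add: min1)
  have above: "val (Suc i) (Suc l) = step_cost (Suc i) (Suc l)
      + indep_prob (Suc l) * (val i (Suc l) - max (gap i (Suc l)) 0)
      + collab_prob (Suc l) * (val i (Suc l) + min (gap i l) 0)"
    using val_Suc[of "Suc l" i] assms by (simp add: min1[of "Suc l"] min2[of l])
  have p: "indep_prob l = 1 - collab_prob l"
      "collab_prob (Suc l) = 1 - indep_prob (Suc l)"
    using prob_sum[of l] prob_sum[of "Suc l"] assms by simp_all
  have "val i l - val i (Suc l) = max (gap i l) 0 + min (gap i l) 0"
    by (simp add: gap_eq)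
  then show ?thesis
    unfolding gap_eq[of "Suc i"] here above p by (simp add: algebra_simps)
qed

text \<open>
  With an empty queue the two stations empty independently: each independent job costs \<open>h1 / \<mu>1\<close>,
  and the collaborative station spends \<open>1 / (min j C2 * \<mu>2)\<close> with \<open>j\<close> jobs for every \<open>j \<le> l\<close>.
\<close>

lemma value_fun_empty_queue:
  "value_fun C2 \<mu>1 \<mu>2 h0 h1 h2 0 k l
    = real k * (h1 / \<mu>1) + (\<Sum>j=1..l. real j * h2 / (real (min j C2) * \<mu>2))"
proof (induction "k + l" arbitrary: k l rule: less_induct)
  case less
  let ?S = "\<lambda>l. \<Sum>j=1..l. real j * h2 / (real (min j C2) * \<mu>2)"
  let ?d = "drate C2 \<mu>1 \<mu>2 k l"
  let ?W = "real k * (h1 / \<mu>1) + ?S l"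
  show ?case
  proof (cases "k = 0 \<and> l = 0")
    case True
    then show ?thesis by simp
  next
    case False
    have nonneg: "real k * \<mu>1 \<ge> 0" "real (min l C2) * \<mu>2 \<ge> 0"
      using \<mu>1_pos \<mu>2_pos by simp_all
    have "real k * \<mu>1 > 0 \<or> real (min l C2) * \<mu>2 > 0"
      using False C2_pos \<mu>1_pos \<mu>2_pos by (auto simp: zero_less_mult_iff)
    then have d: "?d > 0"
      using nonneg unfolding drate_def by linarith
    have indep: "(if k = 0 then 0
        else real k * \<mu>1 / ?d * value_fun C2 \<mu>1 \<mu>2 h0 h1 h2 0 (k - 1) l)
      = (real k * \<mu>1 * ?W - real k * h1) / ?d"
    proof (cases "k = 0")
      case False
      then have "value_fun C2 \<mu>1 \<mu>2 h0 h1 h2 0 (k - 1) l = ?W - h1 / \<mu>1"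
        using less[of "k - 1" l] by (simp add: of_nat_diff algebra_simps del: value_fun.simps)
      then have "real k * \<mu>1 * value_fun C2 \<mu>1 \<mu>2 h0 h1 h2 0 (k - 1) l
          = real k * \<mu>1 * ?W - real k * h1"
        using \<mu>1_pos by (simp add: right_diff_distrib del: value_fun.simps)
      then show ?thesis
        using False by (simp del: value_fun.simps)
    qed simp
    have collab: "(if l = 0 then 0
        else real (min l C2) * \<mu>2 / ?d * value_fun C2 \<mu>1 \<mu>2 h0 h1 h2 0 k (l - 1))
      = (real (min l C2) * \<mu>2 * ?W - real l * h2) / ?d"
    proof (cases "l = 0")
      case False
      then obtain l' where l': "l = Suc l'"
        by (cases l) auto
      have s: "real (min l C2) > 0"
        using False C2_pos by simp
      have "value_fun C2 \<mu>1 \<mu>2 h0 h1 h2 0 k (l - 1)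
          = ?W - real l * h2 / (real (min l C2) * \<mu>2)"
        using less[of k "l - 1"] l' by (simp del: value_fun.simps)
      then have "real (min l C2) * \<mu>2 * value_fun C2 \<mu>1 \<mu>2 h0 h1 h2 0 k (l - 1)
          = real (min l C2) * \<mu>2 * ?W - real l * h2"
        using s \<mu>2_pos by (simp add: right_diff_distrib del: value_fun.simps of_nat_min)
      then show ?thesis
        using False by (simp del: value_fun.simps of_nat_min)
    qed simp
    have "value_fun C2 \<mu>1 \<mu>2 h0 h1 h2 0 k l = (real k * h1 + real l * h2) / ?d
        + (real k * \<mu>1 * ?W - real k * h1) / ?d
        + (real (min l C2) * \<mu>2 * ?W - real l * h2) / ?d"
      unfolding value_fun.simps(1)[of _ _ _ _ _ _ k l] indep collab using False by simp
    also have "\<dots> = ?d * ?W / ?d"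
      unfolding add_divide_distrib[symmetric] by (simp add: drate_def algebra_simps)
    also have "\<dots> = ?W"
      using d by simp
    finally show ?thesis .
  qed
qed

lemma gap_0:
  assumes "l < n"
  shows "gap 0 l = h1 / \<mu>1 - real (Suc l) * h2 / (real (min (Suc l) C2) * \<mu>2)"
proof -
  have "real (n - l) = real (n - Suc l) + 1"
    using assms by linarith
  then show ?thesis
    unfolding gap_eq val_def value_fun_empty_queue by (simp add: algebra_simps)
qed

lemma gap_0_nonpos:
  assumes "l < n"
  shows "gap 0 l \<le> 0"
proof -
  have s: "real (min (Suc l) C2) > 0"
    using C2_pos by simp
  have "real (min (Suc l) C2) * (h2 / \<mu>2) \<le> real (Suc l) * (h2 / \<mu>2)"
    using h2_pos \<mu>2_pos by (intro mult_right_mono) auto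
  then have "h2 / \<mu>2 \<le> real (Suc l) * (h2 / \<mu>2) / real (min (Suc l) C2)"
    using s by (simp only: pos_le_divide_eq mult.commute)
  also have "\<dots> = real (Suc l) * h2 / (real (min (Suc l) C2) * \<mu>2)"
    by (simp add: mult.commute)
  finally show ?thesis
    using gap_0[OF assms] cost_rate_le by linarith
qed

section \<open>The one-step cost gap\<close>

definition slope :: real where
  "slope = h0 / real n * (1 / \<mu>1 - 1 / \<mu>2)"

definition intercept :: real where
  "intercept = h1 / \<mu>1 - h2 / \<mu>2"

definition est :: "nat \<Rightarrow> real" where
  "est i = real i * slope + intercept"

definition weight :: "nat \<Rightarrow> real" where
  "weight l = real n * \<mu>1 * \<mu>2 / (rate l * rate (Suc l))"

lemma est_Suc: "est (Suc i) = est i + slope"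
  by (simp add: est_def algebra_simps)

lemma intercept_nonpos: "intercept \<le> 0"
  using cost_rate_le by (simp add: intercept_def)

lemma weight_pos: "l < n \<Longrightarrow> weight l > 0"
  using rate_pos[of l] rate_pos[of "Suc l"] \<mu>1_pos \<mu>2_pos by (simp add: weight_def)

lemma rate_Suc:
  assumes "l < C2"
  shows "rate (Suc l) = rate l + (\<mu>2 - \<mu>1)"
proof -
  have "real (n - l) = real (n - Suc l) + 1"
    using assms C2_less by linarith
  then show ?thesis
    using assms by (simp add: rate_def drate_def algebra_simps)
qed

lemma rate_below:
  assumes "l < C2"
  shows "rate l = (real (n - Suc l) + 1) * \<mu>1 + real l * \<mu>2"
    "rate (Suc l) = real (n - Suc l) * \<mu>1 + (real l + 1) * \<mu>2"
    "real n = real (n - Suc l) + 1 + real l"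
    "real (n - l) = real (n - Suc l) + 1"
proof -
  show n: "real n = real (n - Suc l) + 1 + real l" "real (n - l) = real (n - Suc l) + 1"
    using assms C2_less by linarith+
  show "rate l = (real (n - Suc l) + 1) * \<mu>1 + real l * \<mu>2"
    "rate (Suc l) = real (n - Suc l) * \<mu>1 + (real l + 1) * \<mu>2"
    using assms n by (simp_all add: rate_def drate_def)
qed

lemma step_cost_gap_below:
  assumes "l < C2"
  shows "step_cost i l - step_cost i (Suc l) = weight l * est i"
proof -
  have n0: "real n > 0" and nz: "rate l \<noteq> 0" "rate (Suc l) \<noteq> 0"
    using assms C2_less rate_pos[of l] rate_pos[of "Suc l"] by simp_all
  have "real n * \<mu>1 * \<mu>2 * est i = real i * h0 * (\<mu>2 - \<mu>1) + real n * (h1 * \<mu>2 - h2 * \<mu>1)"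
    using n0 \<mu>1_pos \<mu>2_pos
    by (simp add: est_def slope_def intercept_def field_simps)
  also have "\<dots> = (real i * h0 + real (n - l) * h1 + real l * h2) * rate (Suc l)
      - (real i * h0 + real (n - Suc l) * h1 + real (Suc l) * h2) * rate l"
    unfolding rate_below[OF assms] by (simp add: algebra_simps)
  finally show ?thesis
    using nz by (simp add: step_cost_def weight_def diff_frac_eq)
qed

text \<open>
  At \<open>l \<ge> C2\<close> another collaborative job adds no service capacity but takes \<open>\<mu>1\<close> away, so moving
  a job there pays only if \<open>h1\<close> is large compared with \<open>h2\<close>; \<open>h1 / \<mu>1 \<le> h2 / \<mu>2\<close> rules this out.
\<close>

lemma step_cost_gap_above:
  assumes "C2 \<le> l" "l < n"
  shows "step_cost i l - step_cost i (Suc l) \<le> 0"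
proof -
  define k where "k = real (n - Suc l)"
  have k: "real (n - l) = k + 1" "real n = k + 1 + real l" "real (n - Suc l) = k"
    unfolding k_def using assms by linarith+
  have r: "rate l = (k + 1) * \<mu>1 + real C2 * \<mu>2" "rate (Suc l) = k * \<mu>1 + real C2 * \<mu>2"
    using assms k by (simp_all add: rate_def drate_def)
  have pos: "rate l > 0" "rate (Suc l) > 0"
    using assms rate_pos by simp_all
  have "h1 * \<mu>2 \<le> h2 * \<mu>1"
    using cost_rate_le \<mu>1_pos \<mu>2_pos by (simp add: field_simps)
  then have "real C2 * (h1 * \<mu>2) \<le> real C2 * (h2 * \<mu>1)"
    by (intro mult_left_mono) simp_all
  also have "\<dots> \<le> real n * (h2 * \<mu>1)"
    using C2_less h2_pos \<mu>1_pos by (intro mult_right_mono) simp_all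
  finally have main: "real C2 * (h1 * \<mu>2) \<le> real n * (h2 * \<mu>1)" .
  have "(real i * h0 + (k + 1) * h1 + real l * h2) * rate (Suc l)
      - (real i * h0 + k * h1 + (real l + 1) * h2) * rate l
      = real C2 * (h1 * \<mu>2) - real n * (h2 * \<mu>1) - real i * h0 * \<mu>1 - real C2 * h2 * \<mu>2"
    unfolding r k by (simp add: algebra_simps)
  also have "\<dots> \<le> 0"
    using main h0_pos h2_pos \<mu>1_pos \<mu>2_pos
    by (smt (verit) mult_nonneg_nonneg of_nat_0_le_iff)
  finally show ?thesis
    using pos unfolding step_cost_def k
    by (simp add: frac_le_eq divide_le_0_iff add.commute
        order_less_imp_le mult_nonneg_nonneg diff_frac_eq)
qed

text \<open>
  The loss \<open>weight l\<close> in the row sum of the recursion is the coefficient of \<open>est\<close> in the cost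
  gap; the recursion therefore averages the old differences with \<open>est\<close>.
\<close>

lemma prob_weight_sum:
  assumes "l < C2"
  shows "indep_prob (Suc l) + collab_prob l = 1 - weight l"
proof -
  have nz: "rate l \<noteq> 0" "rate (Suc l) \<noteq> 0"
    using assms C2_less rate_pos[of l] rate_pos[of "Suc l"] by simp_all
  have "real (n - Suc l) * \<mu>1 * rate l + real l * \<mu>2 * rate (Suc l) + real n * \<mu>1 * \<mu>2
      = rate l * rate (Suc l)"
    unfolding rate_below[OF assms] by (simp add: algebra_simps)
  then show ?thesis
    using nz assms by (simp add: indep_prob_def collab_prob_def weight_def field_simps)
qed

lemma gap_step_below:
  assumes "l < C2"
  shows "gap (Suc i) l = weight l * est (Suc i)
    + collab_prob l * max (gap i l) 0 + indep_prob (Suc l) * min (gap i l) 0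
    + collab_prob l * min (gap i (l - 1)) 0 + indep_prob (Suc l) * max (gap i (Suc l)) 0"
  using gap_step[of l i] step_cost_gap_below[OF assms, of "Suc i"] assms C2_less by simp

lemma gap_0_below: "l < C2 \<Longrightarrow> gap 0 l = intercept"
  using gap_0[of l] C2_less by (simp add: intercept_def)

section \<open>Where no threshold exists\<close>

lemma gap_Suc_nonpos:
  assumes "l < n" "gap i l \<le> 0" "Suc l < n \<Longrightarrow> gap i (Suc l) \<le> 0"
    and "step_cost (Suc i) l - step_cost (Suc i) (Suc l) \<le> 0"
  shows "gap (Suc i) l \<le> 0"
proof -
  have "indep_prob (Suc l) * max (gap i (Suc l)) 0 = 0"
    using assms by (cases "Suc l = n") auto
  moreover have "collab_prob l * min (gap i (l - 1)) 0 \<le> 0"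
    "indep_prob (Suc l) * min (gap i l) 0 \<le> 0"
    using assms collab_prob_nonneg[of l] indep_prob_nonneg[of "Suc l"]
    by (auto intro!: mult_nonneg_nonpos)
  moreover have "collab_prob l * max (gap i l) 0 = 0"
    using assms by simp
  ultimately show ?thesis
    unfolding gap_step[OF assms(1)] using assms(4) by linarith
qed

lemma gap_nonpos_above: "C2 \<le> l \<Longrightarrow> l < n \<Longrightarrow> gap i l \<le> 0"
proof (induction i arbitrary: l)
  case 0
  then show ?case by (simp add: gap_0_nonpos)
next
  case (Suc i)
  then show ?case
    by (intro gap_Suc_nonpos step_cost_gap_above) simp_all
qed

lemma slope_nonpos: "\<mu>2 \<le> \<mu>1 \<Longrightarrow> slope \<le> 0"
  using h0_pos \<mu>1_pos \<mu>2_pos unfolding slope_def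
  by (intro mult_nonneg_nonpos) (simp_all add: frac_le)

lemma est_nonpos: "\<mu>2 \<le> \<mu>1 \<Longrightarrow> est i \<le> 0"
  using slope_nonpos intercept_nonpos mult_nonneg_nonpos[of "real i" slope]
  by (simp add: est_def)

lemma gap_nonpos_slow: "\<mu>2 \<le> \<mu>1 \<Longrightarrow> l < n \<Longrightarrow> gap i l \<le> 0"
proof (induction i arbitrary: l)
  case 0
  then show ?case by (simp add: gap_0_nonpos)
next
  case (Suc i)
  have "step_cost (Suc i) l - step_cost (Suc i) (Suc l) \<le> 0"
  proof (cases "l < C2")
    case True
    then show ?thesis
      using step_cost_gap_below[OF True] weight_pos[of l] est_nonpos[of "Suc i"] Suc.prems
      by (simp add: mult_nonneg_nonpos)
  qed (use step_cost_gap_above Suc.prems in simp)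
  then show ?case
    using Suc by (intro gap_Suc_nonpos) simp_all
qed

end

section \<open>Fast collaborative service\<close>

locale fast_clearing_system = clearing_system +
  assumes fast: "\<mu>1 < \<mu>2"
begin

lemma slope_pos: "slope > 0"
  using h0_pos \<mu>1_pos \<mu>2_pos fast C2_less unfolding slope_def
  by (intro mult_pos_pos) (simp_all add: frac_less2)

text \<open>
  While \<open>est\<close> is negative, so are all differences below \<open>C2\<close>, and the one at \<open>C2\<close> is nonpositive.
  No positive part enters, and the recursion averages \<open>est (i + 1)\<close> with old differences that are
  at most \<open>est i\<close>.
\<close>

lemma gap_le_est: "l < C2 \<Longrightarrow> est i \<le> 0 \<Longrightarrow> gap i l \<le> est i"
proof (induction i arbitrary: l)
  case 0
  then show ?case by (simp add: gap_0_below est_def)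
next
  case (Suc i)
  have neg: "est i < 0"
    using Suc.prems est_Suc[of i] slope_pos by linarith
  have le: "gap i j \<le> est i" if "j < C2" for j
    using Suc.IH[OF that] neg by linarith
  have pred: "l - 1 < C2"
    using Suc.prems by simp
  have "gap i (Suc l) \<le> 0"
    using le[of "Suc l"] neg gap_nonpos_above[of "Suc l" i] Suc.prems C2_less
    by (cases "Suc l < C2") auto
  then have "gap (Suc i) l = weight l * est (Suc i)
      + indep_prob (Suc l) * gap i l + collab_prob l * gap i (l - 1)"
    using gap_step_below[OF Suc.prems(1), of i] le[of l] le[OF pred] neg Suc.prems by simp
  also have "\<dots> \<le> weight l * est (Suc i)
      + indep_prob (Suc l) * est (Suc i) + collab_prob l * est (Suc i)"
    using le[of l] le[OF pred] Suc.prems C2_less slope_pos est_Suc[of i]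
    by (intro add_mono mult_left_mono indep_prob_nonneg collab_prob_nonneg order_refl)
      simp_all
  also have "\<dots> = (weight l + (indep_prob (Suc l) + collab_prob l)) * est (Suc i)"
    by (simp add: algebra_simps)
  also have "\<dots> = est (Suc i)"
    using prob_weight_sum[OF Suc.prems(1)] by simp
  finally show ?case .
qed

lemma min_gap_le_est: "l < C2 \<Longrightarrow> min (gap i l) 0 \<le> est i"
  using gap_le_est[of l i] by linarith

lemma weight_Suc_le:
  assumes "Suc l < C2"
  shows "weight (Suc l) \<le> weight l"
proof -
  have "rate l > 0" "rate (Suc l) > 0"
    using assms C2_less rate_pos[of l] rate_pos[of "Suc l"] by simp_all
  moreover have "rate (Suc (Suc l)) \<ge> rate l"
    using assms fast rate_Suc[of l] rate_Suc[of "Suc l"] by simp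
  ultimately have "0 < rate l" "0 < rate (Suc l)" "rate l \<le> rate (Suc (Suc l))"
    "0 < rate (Suc (Suc l))"
    by simp_all
  then show ?thesis
    unfolding weight_def using \<mu>1_pos \<mu>2_pos
    by (intro divide_left_mono) (simp_all add: mult.commute)
qed

text \<open>
  If \<open>gap i l\<close> is positive, so is \<open>gap (i + 1) l\<close>, because \<open>est (i + 1)\<close> is positive and no
  negative part enters. Otherwise let \<open>y = gap i l \<le> 0\<close>. By induction, replacing all old negative
  parts by \<open>y\<close> can only raise \<open>gap (i + 1) (l + 1)\<close> and only lower \<open>gap (i + 1) l\<close>. Both are then
  averages of \<open>est (i + 1) \<ge> y\<close> and \<open>y\<close>, and the one at \<open>l\<close> has the larger weight on \<open>est (i + 1)\<close>.
\<close>

lemma gap_single_crossing: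
  "Suc l < C2 \<Longrightarrow> gap i (Suc l) \<le> gap i l \<or> gap i l > 0"
proof (induction i arbitrary: l)
  case 0
  then show ?case by (simp add: gap_0_below)
next
  case (Suc i)
  note l = Suc.prems
  then have below: "l < C2"
    by simp
  have mono: "min (gap i l) 0 \<le> min (gap i (l - 1)) 0"
    using Suc.IH[of "l - 1"] l by (cases l) auto
  have nonneg: "indep_prob (Suc l) \<ge> 0" "collab_prob l \<ge> 0"
    "indep_prob (Suc (Suc l)) \<ge> 0" "collab_prob (Suc l) \<ge> 0"
    using l C2_less by (simp_all add: indep_prob_nonneg collab_prob_nonneg)
  show ?case
  proof (cases "gap i l > 0")
    case True
    then have "est (Suc i) > 0"
      using min_gap_le_est[of l i] l est_Suc[of i] slope_pos by simp
    then have pos: "weight l * est (Suc i) > 0"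
      using weight_pos[of l] l C2_less by simp
    have "collab_prob l * max (gap i l) 0 \<ge> 0" "indep_prob (Suc l) * max (gap i (Suc l)) 0 \<ge> 0"
      using nonneg by simp_all
    moreover have "min (gap i l) 0 = 0" "min (gap i (l - 1)) 0 = 0"
      using True mono by simp_all
    ultimately have "gap (Suc i) l > 0"
      using gap_step_below[of l i] l pos by simp
    then show ?thesis ..
  next
    case False
    define y where "y = gap i l"
    have y: "y \<le> 0" "gap i (Suc l) \<le> y" "y \<le> min (gap i (l - 1)) 0"
      using False Suc.IH[OF l] mono by (auto simp: y_def)
    have above: "gap i (Suc (Suc l)) \<le> 0"
    proof (cases "Suc (Suc l) < C2")
      case True
      then show ?thesis
        using Suc.IH[OF True] y by linarith
    qed (use gap_nonpos_above l C2_less in simp)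
    have y_est: "y \<le> est (Suc i)"
      using min_gap_le_est[of l i] l y est_Suc[of i] slope_pos by (simp add: y_def)
    have "gap (Suc i) (Suc l) = weight (Suc l) * est (Suc i)
        + indep_prob (Suc (Suc l)) * gap i (Suc l) + collab_prob (Suc l) * y"
      using gap_step_below[OF l, of i] y above by (simp add: y_def)
    also have "\<dots> \<le> weight (Suc l) * est (Suc i)
        + indep_prob (Suc (Suc l)) * y + collab_prob (Suc l) * y"
      using y nonneg by (simp add: mult_left_mono)
    also have "\<dots> = weight (Suc l) * est (Suc i)
        + (indep_prob (Suc (Suc l)) + collab_prob (Suc l)) * y"
      by (simp add: algebra_simps)
    also have "\<dots> = est (Suc i) - (1 - weight (Suc l)) * (est (Suc i) - y)"
      unfolding prob_weight_sum[OF l] by (simp add: algebra_simps)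
    also have "\<dots> \<le> est (Suc i) - (1 - weight l) * (est (Suc i) - y)"
      using weight_Suc_le[OF l] y_est by (simp add: mult_right_mono)
    also have "\<dots> = weight l * est (Suc i) + (indep_prob (Suc l) + collab_prob l) * y"
      unfolding prob_weight_sum[OF below] by (simp add: algebra_simps)
    also have "\<dots> = weight l * est (Suc i) + indep_prob (Suc l) * y + collab_prob l * y"
      by (simp add: algebra_simps)
    also have "\<dots> \<le> weight l * est (Suc i) + indep_prob (Suc l) * y
        + collab_prob l * min (gap i (l - 1)) 0"
      using y nonneg by (intro add_left_mono mult_left_mono)
    also have "\<dots> = gap (Suc i) l"
      using gap_step_below[of l i] l y by (simp add: y_def)
    finally show ?thesis ..
  qed
qed

text \<open>
  \<open>lag\<close> is the stationary solution of the recursion for \<open>(est i - gap i l) / slope\<close> when only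
  negative parts enter; \<open>lag_stationary\<close> is that equation.
\<close>

definition lag :: "nat \<Rightarrow> real" where
  "lag l = real (n - Suc l) * (\<mu>1 / \<mu>2) + real l"

lemma lag_le:
  assumes "l < n"
  shows "lag l \<le> real (n - 1)"
proof -
  have "real (n - Suc l) * (\<mu>1 / \<mu>2) \<le> real (n - Suc l) * 1"
    using fast \<mu>2_pos by (intro mult_left_mono) simp_all
  then show ?thesis
    using assms by (simp add: lag_def)
qed

lemma lag_nonneg: "lag l \<ge> 0"
  using \<mu>1_pos \<mu>2_pos by (simp add: lag_def)

lemma lag_stationary:
  assumes "l < C2"
  shows "(1 - weight l) + indep_prob (Suc l) * lag l + collab_prob l * lag (l - 1) = lag l"
proof -
  define k where "k = real (n - Suc l)"
  define x where "x = real l"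
  note r = rate_below[OF assms, folded k_def x_def]
  have pos: "rate l > 0" "rate (Suc l) > 0"
    using assms C2_less rate_pos by simp_all
  define A where "A = k * \<mu>1 + x * \<mu>2"
  define B where "B = (k + 1) * \<mu>1 + (x - 1) * \<mu>2"
  have lag_l: "lag l = A / \<mu>2"
    using \<mu>2_pos by (simp add: lag_def A_def k_def x_def field_simps)
  have prev: "collab_prob l * lag (l - 1) = collab_prob l * (B / \<mu>2)"
  proof (cases l)
    case (Suc l')
    then have "lag (l - 1) = (k + 1) * (\<mu>1 / \<mu>2) + (x - 1)"
      using r(4) by (simp add: lag_def x_def)
    also have "\<dots> = B / \<mu>2"
      using \<mu>2_pos by (simp add: B_def field_simps)
    finally show ?thesis
      by (rule arg_cong)
  qed simp
  have probs: "indep_prob (Suc l) = k * \<mu>1 / rate (Suc l)" "collab_prob l = x * \<mu>2 / rate l"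
    using assms by (simp_all add: indep_prob_def collab_prob_def k_def x_def)
  define M where "M = real n * \<mu>1 * \<mu>2"
  have identity: "(rate l * rate (Suc l) - M) * \<mu>2 + k * \<mu>1 * A * rate l + x * \<mu>2 * B * rate (Suc l)
      = rate l * rate (Suc l) * A"
    unfolding r M_def A_def B_def by (simp add: algebra_simps)
  have "(1 - M / (rate l * rate (Suc l))) + k * \<mu>1 / rate (Suc l) * (A / \<mu>2)
      + x * \<mu>2 / rate l * (B / \<mu>2)
    = ((rate l * rate (Suc l) - M) * \<mu>2 + k * \<mu>1 * A * rate l + x * \<mu>2 * B * rate (Suc l))
      / (rate l * rate (Suc l) * \<mu>2)"
    using pos \<mu>2_pos by (simp add: field_simps)
  also have "\<dots> = A / \<mu>2"
    unfolding identity using pos by simp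
  finally show ?thesis
    unfolding prev unfolding lag_l probs weight_def M_def .
qed

text \<open>
  This serves the steps at which \<open>est i - slope * lag l\<close>, the lower bound for \<open>gap i l\<close>, is
  still nonpositive but its value for \<open>l - 1\<close> is not. The former then exceeds
  \<open>- slope * (1 - \<mu>1 / \<mu>2)\<close>, and the inequality says that \<open>weight l * est (i + 1)\<close> outweighs it.
\<close>

lemma weight_lag_ge:
  assumes "l < C2"
  shows "indep_prob (Suc l) * (1 - \<mu>1 / \<mu>2) \<le> weight l * lag l"
proof -
  define k where "k = real (n - Suc l)"
  define x where "x = real l"
  note r = rate_below[OF assms, folded k_def x_def]
  have pos: "rate l > 0" "rate (Suc l) > 0"
    using assms C2_less rate_pos by simp_all
  have kx: "k \<ge> 0" "x \<ge> 0"
    by (simp_all add: k_def x_def)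
  have "k * rate l * (1 - \<mu>1 / \<mu>2) \<le> k * rate l * 1"
    using kx pos \<mu>1_pos \<mu>2_pos by (intro mult_left_mono) simp_all
  also have "\<dots> \<le> (k + 1 + x) * (k * \<mu>1 + x * \<mu>2)"
    unfolding r using kx \<mu>1_pos \<mu>2_pos by (simp add: algebra_simps)
  finally have "\<mu>1 * (k * rate l * (1 - \<mu>1 / \<mu>2)) \<le> \<mu>1 * ((k + 1 + x) * (k * \<mu>1 + x * \<mu>2))"
    using \<mu>1_pos by (intro mult_left_mono) simp_all
  then have "\<mu>1 * (k * rate l * (1 - \<mu>1 / \<mu>2)) / (rate l * rate (Suc l))
      \<le> \<mu>1 * ((k + 1 + x) * (k * \<mu>1 + x * \<mu>2)) / (rate l * rate (Suc l))"
    using pos by (intro divide_right_mono) simp_all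
  moreover have "indep_prob (Suc l) * (1 - \<mu>1 / \<mu>2)
      = \<mu>1 * (k * rate l * (1 - \<mu>1 / \<mu>2)) / (rate l * rate (Suc l))"
    using pos by (simp add: indep_prob_def k_def)
  moreover have "weight l * lag l = \<mu>1 * ((k + 1 + x) * (k * \<mu>1 + x * \<mu>2)) / (rate l * rate (Suc l))"
    unfolding weight_def lag_def r(3) using pos \<mu>2_pos
    by (simp add: k_def x_def field_simps)
  ultimately show ?thesis
    by simp
qed

lemma lag_pred:
  assumes "l < n"
  shows "lag (l - 1) \<le> lag l" "lag l \<le> lag (l - 1) + (1 - \<mu>1 / \<mu>2)"
proof -
  have "lag l = lag (l - 1) + (1 - \<mu>1 / \<mu>2)" if "l \<noteq> 0"
  proof -
    have "real (n - l) = real (n - Suc l) + 1"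
      using assms by linarith
    then show ?thesis
      using that by (simp add: lag_def algebra_simps)
  qed
  moreover have "1 - \<mu>1 / \<mu>2 \<ge> 0"
    using fast \<mu>2_pos by simp
  ultimately show "lag (l - 1) \<le> lag l" "lag l \<le> lag (l - 1) + (1 - \<mu>1 / \<mu>2)"
    by (cases "l = 0"; simp)+
qed

text \<open>
  The bound is preserved through the identity \<open>lag_stationary\<close> as long as it is nonpositive at
  \<open>l - 1\<close> and \<open>l\<close>. Capping it at \<open>0\<close> breaks this identity, but only once \<open>est (i + 1)\<close> is large
  enough to make \<open>gap (i + 1) l\<close> positive outright.
\<close>

lemma gap_ge_lagged:
  assumes "l < C2"
  shows "min (est i - slope * lag l) 0 \<le> gap i l
    \<and> (est i - slope * lag l > 0 \<longrightarrow> gap i l > 0)"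
  using assms
proof (induction i arbitrary: l)
  case 0
  have "slope * lag l \<ge> 0"
    using slope_pos lag_nonneg by simp
  then show ?case
    using 0 intercept_nonpos by (auto simp: gap_0_below est_def)
next
  case (Suc i)
  note l = Suc.prems
  define G where "G = (\<lambda>i l. est i - slope * lag l)"
  have IH: "min (G i j) 0 \<le> min (gap i j) 0" if "j < C2" for j
    using Suc.IH[OF that] by (simp add: G_def)
  have nonneg: "indep_prob (Suc l) \<ge> 0" "collab_prob l \<ge> 0"
    using l C2_less by (simp_all add: indep_prob_nonneg collab_prob_nonneg)
  have w: "weight l > 0"
    using l C2_less by (simp add: weight_pos)
  have "weight l * est (Suc i) + indep_prob (Suc l) * min (G i l) 0
      + collab_prob l * min (G i (l - 1)) 0
    \<le> weight l * est (Suc i) + indep_prob (Suc l) * min (gap i l) 0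
      + collab_prob l * min (gap i (l - 1)) 0"
    using IH[of l] IH[of "l - 1"] l nonneg
    by (intro add_mono mult_left_mono order_refl) simp_all
  also have "\<dots> \<le> gap (Suc i) l"
    using gap_step_below[OF l, of i] nonneg by simp
  finally have bound: "weight l * est (Suc i) + indep_prob (Suc l) * min (G i l) 0
      + collab_prob l * min (G i (l - 1)) 0 \<le> gap (Suc i) l" .
  have G_Suc: "G (Suc i) j = G i j + slope" for j
    by (simp add: G_def est_Suc)
  have G_step: "weight l * est (Suc i) + indep_prob (Suc l) * G i l
      + collab_prob l * G i (l - 1) = G (Suc i) l"
  proof -
    have stationary: "indep_prob (Suc l) * lag l + collab_prob l * lag (l - 1)
        = lag l - (1 - weight l)"
      using lag_stationary[OF l] by linarith
    have "weight l * est (Suc i) + indep_prob (Suc l) * G i l + collab_prob l * G i (l - 1)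
      = weight l * est (Suc i) + (indep_prob (Suc l) + collab_prob l) * est i
        - slope * (indep_prob (Suc l) * lag l + collab_prob l * lag (l - 1))"
      by (simp add: G_def algebra_simps)
    also have "\<dots> = weight l * est (Suc i) + (1 - weight l) * (est (Suc i) - slope)
        - slope * (lag l - (1 - weight l))"
      unfolding stationary prob_weight_sum[OF l] by (simp add: est_Suc)
    also have "\<dots> = G (Suc i) l"
      by (simp add: G_def algebra_simps)
    finally show ?thesis .
  qed
  consider "G i l > 0" | "G i l \<le> 0" "G i (l - 1) > 0" | "G i l \<le> 0" "G i (l - 1) \<le> 0"
    by linarith
  then show ?case
  proof cases
    case 1
    have "slope * lag l \<ge> 0"
      using slope_pos lag_nonneg by simp
    then have "est (Suc i) > 0"
      using 1 slope_pos est_Suc[of i] by (simp add: G_def)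
    then have pos: "weight l * est (Suc i) > 0"
      using w by simp
    have "G i l \<le> G i (l - 1)"
      using lag_pred(1)[of l] l C2_less slope_pos by (simp add: G_def)
    then have "collab_prob l * min (G i (l - 1)) 0 = 0"
      using 1 by simp
    moreover have "indep_prob (Suc l) * min (G i l) 0 = 0"
      using 1 by simp
    ultimately have "gap (Suc i) l > 0"
      using bound pos by linarith
    then show ?thesis
      by simp
  next
    case 2
    have "slope * (lag l - lag (l - 1)) \<le> slope * (1 - \<mu>1 / \<mu>2)"
      using lag_pred(2)[of l] l C2_less slope_pos by (intro mult_left_mono) simp_all
    then have near: "G i l > - (slope * (1 - \<mu>1 / \<mu>2))"
      using 2 by (simp add: G_def algebra_simps)
    moreover have "- slope < - (slope * (1 - \<mu>1 / \<mu>2))"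
      using slope_pos \<mu>1_pos \<mu>2_pos by (simp add: algebra_simps)
    ultimately have "G (Suc i) l > 0"
      using G_Suc[of l] by linarith
    then have "weight l * (slope * lag l) < weight l * est (Suc i)"
      using w by (simp add: G_def)
    moreover have "slope * (indep_prob (Suc l) * (1 - \<mu>1 / \<mu>2)) \<le> slope * (weight l * lag l)"
      using weight_lag_ge[OF l] slope_pos by (intro mult_left_mono) simp_all
    moreover have "indep_prob (Suc l) * - (slope * (1 - \<mu>1 / \<mu>2)) \<le> indep_prob (Suc l) * G i l"
      using near nonneg by (intro mult_left_mono) simp_all
    ultimately have "weight l * est (Suc i) + indep_prob (Suc l) * G i l > 0"
      by (simp add: algebra_simps)
    then have "gap (Suc i) l > 0"
      using bound 2 by simp
    then show ?thesis
      by simp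
  next
    case 3
    then have "G (Suc i) l \<le> gap (Suc i) l"
      using bound G_step by simp
    then show ?thesis
      by (auto simp: G_def)
  qed
qed

end

section \<open>The thresholds\<close>

context clearing_system
begin

lemma H_fun_below: "l < C2 \<Longrightarrow> H_fun n C2 \<mu>1 \<mu>2 h0 h1 h2 i k l = est i"
  by (simp add: H_fun_def est_def slope_def intercept_def Let_def)

lemma H_fun_above:
  assumes "C2 \<le> l"
  shows "H_fun n C2 \<mu>1 \<mu>2 h0 h1 h2 i k l = - 1"
proof -
  have "1 * (h2 / \<mu>2) \<le> (real l + 1) / real C2 * (h2 / \<mu>2)"
    using assms C2_pos h2_pos \<mu>2_pos by (intro mult_right_mono) simp_all
  then show ?thesis
    using assms cost_rate_le by (simp add: H_fun_def Let_def)
qed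

lemma i_D_eq: "i_D n C2 \<mu>1 \<mu>2 h0 h1 h2 l = Inf (enat ` {i. gap i l > 0})"
  by (simp add: i_D_def gap_def)

lemma i_D_infinite: "(\<And>i. gap i l \<le> 0) \<Longrightarrow> i_D n C2 \<mu>1 \<mu>2 h0 h1 h2 l = \<infinity>"
  by (simp add: i_D_eq not_less[symmetric] Inf_enat_def)

lemma i_H_infinite:
  "(\<And>i. H_fun n C2 \<mu>1 \<mu>2 h0 h1 h2 i (n - l) l \<le> 0) \<Longrightarrow> i_H n C2 \<mu>1 \<mu>2 h0 h1 h2 l = \<infinity>"
  by (simp add: i_H_def not_less[symmetric] Inf_enat_def)

lemma i_D_infinite_above:
  "C2 \<le> l \<Longrightarrow> l < n \<Longrightarrow> i_D n C2 \<mu>1 \<mu>2 h0 h1 h2 l = \<infinity>"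
  by (intro i_D_infinite gap_nonpos_above)

lemma i_D_infinite_slow:
  "\<mu>2 \<le> \<mu>1 \<Longrightarrow> l < n \<Longrightarrow> i_D n C2 \<mu>1 \<mu>2 h0 h1 h2 l = \<infinity>"
  by (intro i_D_infinite gap_nonpos_slow)

lemma i_H_infinite_above: "C2 \<le> l \<Longrightarrow> i_H n C2 \<mu>1 \<mu>2 h0 h1 h2 l = \<infinity>"
  by (intro i_H_infinite) (simp add: H_fun_above)

lemma i_H_infinite_slow:
  "\<mu>2 \<le> \<mu>1 \<Longrightarrow> l < C2 \<Longrightarrow> i_H n C2 \<mu>1 \<mu>2 h0 h1 h2 l = \<infinity>"
  by (intro i_H_infinite) (simp add: H_fun_below est_nonpos)

end

context fast_clearing_system
begin

lemma i_D_mono_below: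
  assumes "Suc l < C2"
  shows "i_D n C2 \<mu>1 \<mu>2 h0 h1 h2 l \<le> i_D n C2 \<mu>1 \<mu>2 h0 h1 h2 (Suc l)"
proof -
  have "gap i l > 0" if "gap i (Suc l) > 0" for i
    using gap_single_crossing[OF assms, of i] that by linarith
  then show ?thesis
    unfolding i_D_eq by (intro Inf_superset_mono image_mono) auto
qed

lemma i_H_le_i_D:
  assumes "l < C2"
  shows "i_H n C2 \<mu>1 \<mu>2 h0 h1 h2 l \<le> i_D n C2 \<mu>1 \<mu>2 h0 h1 h2 l"
proof -
  have "est i > 0" if "gap i l > 0" for i
    using gap_le_est[OF assms, of i] that by linarith
  then show ?thesis
    unfolding i_D_eq i_H_def H_fun_below[OF assms]
    by (intro Inf_superset_mono image_mono) auto
qed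

lemma i_D_le_i_H:
  assumes "l < C2"
  shows "i_D n C2 \<mu>1 \<mu>2 h0 h1 h2 l \<le> i_H n C2 \<mu>1 \<mu>2 h0 h1 h2 l + enat (n - 1)"
proof (cases "\<exists>i. est i > 0")
  case False
  then have "i_H n C2 \<mu>1 \<mu>2 h0 h1 h2 l = \<infinity>"
    by (intro i_H_infinite) (simp add: H_fun_below assms not_less)
  then show ?thesis
    by simp
next
  case True
  define S where "S = enat ` {i. est i > 0}"
  have "S \<noteq> {}"
    using True by (simp add: S_def)
  then have "Inf S \<in> S"
    by (meson ex_in_conv wellorder_InfI)
  then obtain j where j: "Inf S = enat j" "est j > 0"
    by (auto simp: S_def)
  have "slope * lag l \<le> slope * real (n - 1)"
    using lag_le[of l] assms C2_less slope_pos by (intro mult_left_mono) simp_all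
  also have "\<dots> = est (j + (n - 1)) - est j"
    by (simp add: est_def algebra_simps)
  finally have "gap (j + (n - 1)) l > 0"
    using gap_ge_lagged[OF assms, of "j + (n - 1)"] j(2) by linarith
  then have "i_D n C2 \<mu>1 \<mu>2 h0 h1 h2 l \<le> enat (j + (n - 1))"
    unfolding i_D_eq by (intro Inf_lower) auto
  also have "\<dots> = i_H n C2 \<mu>1 \<mu>2 h0 h1 h2 l + enat (n - 1)"
    using j(1) by (simp add: i_H_def H_fun_below[OF assms] S_def)
  finally show ?thesis .
qed

end

theorem theorem4p2:
  fixes C1 C2 :: nat and \<mu>1 \<mu>2 h0 h1 h2 :: real
  assumes "1 \<le> C1" and "1 \<le> C2" and "C2 < C1"
    and "\<mu>1 > 0" and "\<mu>2 > 0" and "h0 > 0" and "h1 > 0" and "h2 > 0"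
    and "h1 / \<mu>1 \<le> h2 / \<mu>2"
  shows "(\<forall>l\<in>{1..C1 - 1}.
            i_D C1 C2 \<mu>1 \<mu>2 h0 h1 h2 (l - 1) \<le> i_D C1 C2 \<mu>1 \<mu>2 h0 h1 h2 l) \<and>
         (\<forall>l\<in>{0..C1 - 1}.
            (\<mu>1 < \<mu>2 \<and> l < C2 \<longrightarrow>
               i_H C1 C2 \<mu>1 \<mu>2 h0 h1 h2 l \<le> i_D C1 C2 \<mu>1 \<mu>2 h0 h1 h2 l \<and>
               i_D C1 C2 \<mu>1 \<mu>2 h0 h1 h2 l \<le> i_H C1 C2 \<mu>1 \<mu>2 h0 h1 h2 l + enat (C1 - 1)) \<and>
            ((\<mu>1 \<ge> \<mu>2 \<and> l < C2) \<or> l \<ge> C2 \<longrightarrow>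
               i_H C1 C2 \<mu>1 \<mu>2 h0 h1 h2 l = \<infinity> \<and> i_D C1 C2 \<mu>1 \<mu>2 h0 h1 h2 l = \<infinity>))"
proof -
  interpret clearing_system C1 C2 \<mu>1 \<mu>2 h0 h1 h2
    using assms by unfold_locales simp_all
  have fast: "fast_clearing_system C1 C2 \<mu>1 \<mu>2 h0 h1 h2" if "\<mu>1 < \<mu>2"
    using that by unfold_locales
  have "i_D C1 C2 \<mu>1 \<mu>2 h0 h1 h2 (l - 1) \<le> i_D C1 C2 \<mu>1 \<mu>2 h0 h1 h2 l"
    if "1 \<le> l" "l < C1" for l
  proof (cases "\<mu>1 < \<mu>2 \<and> l < C2")
    case True
    then show ?thesis
      using fast_clearing_system.i_D_mono_below[OF fast, of "l - 1"] that by simp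
  next
    case False
    then have "i_D C1 C2 \<mu>1 \<mu>2 h0 h1 h2 l = \<infinity>"
      using i_D_infinite_above i_D_infinite_slow that by (meson not_less)
    then show ?thesis
      by simp
  qed
  then show ?thesis
    using fast_clearing_system.i_H_le_i_D[OF fast] fast_clearing_system.i_D_le_i_H[OF fast]
      i_D_infinite_above i_D_infinite_slow i_H_infinite_above i_H_infinite_slow assms(1,3)
    by (auto simp: Suc_le_eq)
qed

end
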